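(* Let $X$ be a set and let $\mathcal{LSS}_X$ be a large scale structure on $X$. Then the following conditions are equivalent: (a) There is an $\infty$-metric $d_X$ on $X$ such that $\mathcal{LSS}_X=\mathcal{LSS}(X,d_X)$. (b) $\mathcal{LSS}_X$ is generated by a countable set (of families of subsets of $X$).
   Context: For $B\subset X$ and a family $\mathcal U$ of subsets of $X$, the star $\mathrm{St}(B,\mathcal U)$ is the union of those elements of $\mathcal U$ that intersect $B$. For families $\mathcal B,\mathcal U$ of subsets of $X$, $\mathrm{St}(\mathcal B,\mathcal U)=\{\mathrm{St}(B,\mathcal U)\}_{B\in\mathcal B}$. A large scale structure $\mathcal{LSS}_X$ on a set $X$ is a non-empty set of families of subsets of $X$ (the uniformly bounded families) such that: (1) if $\mathcal B_1\in\mathcal{LSS}_X$ and $\mathcal B_2$ is a family of subsets of $X$ such that each element of $\mathcal B_2$ consisting of more than one point is contained in some element of $\mathcal B_1$, then $\mathcal B_2\in\mathcal{LSS}_X$; (2) $\mathcal B_1,\mathcal B_2\in\mathcal{LSS}_X$ implies $\mathrm{St}(\mathcal B_1,\mathcal B_2)\in\mathcal{LSS}_X$. A family $\mathcal B$ is a refinement of (refines) $\mathcal B'$ if every element of $\mathcal B$ is contained in some element of $\mathcal B'$. The trivial extension of $\mathcal B$ is $e(\mathcal B)=\mathcal B\cup\{\{x\}\}_{x\in X}$. Generation: let $\mathcal{LSS}'_X$ be a set of families of subsets of $X$ such that for all $\mathcal B_1,\mathcal B_2\in\mathcal{LSS}'_X$ there is $\mathcal B_3\in\mathcal{LSS}'_X$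 such that $\mathcal B_1\cup\mathcal B_2\cup\mathrm{St}(\mathcal B_1,\mathcal B_2)$ refines $\mathcal B_3$. The large scale structure $\mathcal{LSS}_X$ is said to be generated by $\mathcal{LSS}'_X$ if $\mathcal{LSS}_X$ consists of all refinements of trivial extensions of elements of $\mathcal{LSS}'_X$. An $\infty$-metric on $X$ is a function $d\colon X\times X\to[0,\infty]$ satisfying all the usual axioms of a metric (with $x+\infty=\infty$). For an $\infty$-metric $d$ on $X$, $\mathcal{LSS}(X,d)$ is the large scale structure consisting of all families $\mathcal B$ of subsets of $X$ for which there is a real $M>0$ such that all elements of $\mathcal B$ have diameter at most $M$. *)

theory Defs
  imports Complex_Main "HOL-Library.Countable_Set" "HOL-Library.Extended_Nonnegative_Real"
begin

definition star :: "'a set \<Rightarrow> 'a set set \<Rightarrow> 'a set" where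
  "star B \<U> = \<Union> {U \<in> \<U>. U \<inter> B \<noteq> {}}"

definition star_family :: "'a set set \<Rightarrow> 'a set set \<Rightarrow> 'a set set" where
  "star_family \<B> \<U> = (\<lambda>B. star B \<U>) ` \<B>"

definition refines :: "'a set set \<Rightarrow> 'a set set \<Rightarrow> bool" where
  "refines \<B> \<B>' \<longleftrightarrow> (\<forall>B\<in>\<B>. \<exists>B'\<in>\<B>'. B \<subseteq> B')"

definition trivial_extension :: "'a set \<Rightarrow> 'a set set \<Rightarrow> 'a set set" where
  "trivial_extension X \<B> = \<B> \<union> {{x} | x. x \<in> X}"

definition large_scale_structure :: "'a set \<Rightarrow> 'a set set set \<Rightarrow> bool" where
  "large_scale_structure X \<L> \<longleftrightarrow>
     \<L> \<noteq> {} \<and>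
     (\<forall>\<B>\<in>\<L>. \<B> \<subseteq> Pow X) \<and>
     (\<forall>\<B>1\<in>\<L>. \<forall>\<B>2. \<B>2 \<subseteq> Pow X \<longrightarrow>
        (\<forall>B\<in>\<B>2. (\<exists>x\<in>B. \<exists>y\<in>B. x \<noteq> y) \<longrightarrow> (\<exists>C\<in>\<B>1. B \<subseteq> C)) \<longrightarrow> \<B>2 \<in> \<L>) \<and>
     (\<forall>\<B>1\<in>\<L>. \<forall>\<B>2\<in>\<L>. star_family \<B>1 \<B>2 \<in> \<L>)"

text \<open>Being generated by a set of families includes the directedness condition that
  the generating set must satisfy.\<close>

definition generated_by :: "'a set \<Rightarrow> 'a set set set \<Rightarrow> 'a set set set \<Rightarrow> bool" where
  "generated_by X \<L> \<L>' \<longleftrightarrow>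
     (\<forall>\<B>\<in>\<L>'. \<B> \<subseteq> Pow X) \<and>
     (\<forall>\<B>1\<in>\<L>'. \<forall>\<B>2\<in>\<L>'. \<exists>\<B>3\<in>\<L>'. refines (\<B>1 \<union> \<B>2 \<union> star_family \<B>1 \<B>2) \<B>3) \<and>
     \<L> = {\<B>. \<exists>\<B>'\<in>\<L>'. refines \<B> (trivial_extension X \<B>')}"

text \<open>Only the values of \<open>d\<close> on \<open>X \<times> X\<close> are relevant.\<close>

definition infinity_metric_on :: "'a set \<Rightarrow> ('a \<Rightarrow> 'a \<Rightarrow> ennreal) \<Rightarrow> bool" where
  "infinity_metric_on X d \<longleftrightarrow>
     (\<forall>x\<in>X. \<forall>y\<in>X. d x y = 0 \<longleftrightarrow> x = y) \<and>
     (\<forall>x\<in>X. \<forall>y\<in>X. d x y = d y x) \<and>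
     (\<forall>x\<in>X. \<forall>y\<in>X. \<forall>z\<in>X. d x z \<le> d x y + d y z)"

text \<open>The supremum is taken in \<open>[0,\<infinity>]\<close>, so the empty set has diameter 0.\<close>

definition infinity_diameter :: "('a \<Rightarrow> 'a \<Rightarrow> ennreal) \<Rightarrow> 'a set \<Rightarrow> ennreal" where
  "infinity_diameter d B = (SUP x\<in>B. SUP y\<in>B. d x y)"

definition metric_lss :: "'a set \<Rightarrow> ('a \<Rightarrow> 'a \<Rightarrow> ennreal) \<Rightarrow> 'a set set set" where
  "metric_lss X d =
     {\<B>. \<B> \<subseteq> Pow X \<and> (\<exists>M::real. M > 0 \<and> (\<forall>B\<in>\<B>. infinity_diameter d B \<le> ennreal M))}"

end

theory Submission imports Defs begin

text \<open>
  A metric structure is generated by the families of all sets of diameter at most \<open>n + 1\<close>.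
  Conversely, a countable generating set can be thinned out to a cofinal sequence
  \<open>C\<^sub>0, C\<^sub>1, \<dots>\<close> such that each \<open>C\<^sub>n\<close> and its star with itself refine \<open>C\<^sub>n\<^sub>+\<^sub>1\<close>. Put
  \<open>d x y = n + 1\<close> for the least \<open>n\<close> such that some element of \<open>C\<^sub>n\<close> contains both points
  \<open>x \<noteq> y\<close>. The triangle inequality holds because \<open>max m n + 2 \<le> (m + 1) + (n + 1)\<close>.
\<close>

section \<open>Refinement, trivial extensions and the first axiom\<close>

lemma refines_trans: "refines \<A> \<B> \<Longrightarrow> refines \<B> \<C> \<Longrightarrow> refines \<A> \<C>"
  unfolding refines_def by (meson subset_trans)

lemma refines_Un_iff: "refines (\<A> \<union> \<B>) \<C> \<longleftrightarrow> refines \<A> \<C> \<and> refines \<B> \<C>"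
  by (auto simp: refines_def)

lemma refines_trivial_extension: "refines \<B> (trivial_extension X \<B>)"
  by (auto simp: refines_def trivial_extension_def)

lemma trivial_extension_mono:
  "refines \<A> \<B> \<Longrightarrow> refines (trivial_extension X \<A>) (trivial_extension X \<B>)"
  unfolding refines_def trivial_extension_def by blast

text \<open>Axiom (1) with the two distinct points turned into premises, so that one of them can
  serve as the centre of a star when the containing element is constructed.\<close>

lemma large_scale_structure_coarse_refinement:
  assumes "large_scale_structure X \<L>" "\<C> \<in> \<L>" "\<B> \<subseteq> Pow X"
    and "\<And>B x y. B \<in> \<B> \<Longrightarrow> x \<in> B \<Longrightarrow> y \<in> B \<Longrightarrow> x \<noteq> y \<Longrightarrow> \<exists>C\<in>\<C>. B \<subseteq> C"
  shows "\<B> \<in> \<L>"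
proof -
  have "\<forall>B\<in>\<B>. (\<exists>x\<in>B. \<exists>y\<in>B. x \<noteq> y) \<longrightarrow> (\<exists>C\<in>\<C>. B \<subseteq> C)"
    using assms(4) by meson
  moreover have "\<forall>\<B>1\<in>\<L>. \<forall>\<B>2. \<B>2 \<subseteq> Pow X \<longrightarrow>
      (\<forall>B\<in>\<B>2. (\<exists>x\<in>B. \<exists>y\<in>B. x \<noteq> y) \<longrightarrow> (\<exists>C\<in>\<B>1. B \<subseteq> C)) \<longrightarrow> \<B>2 \<in> \<L>"
    using assms(1) unfolding large_scale_structure_def by (elim conjE)
  ultimately show ?thesis
    using assms(2,3) by simp
qed

section \<open>Diameters and bounded families\<close>

lemma infinity_diameter_le_iff:
  "infinity_diameter d B \<le> M \<longleftrightarrow> (\<forall>x\<in>B. \<forall>y\<in>B. d x y \<le> M)"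
  by (simp add: infinity_diameter_def SUP_le_iff)

lemma infinity_diameter_mono: "A \<subseteq> B \<Longrightarrow> infinity_diameter d A \<le> infinity_diameter d B"
  unfolding infinity_diameter_def by (blast intro: SUP_subset_mono)

text \<open>By the Archimedean property integer bounds suffice, which is why countably many
  generators are enough. Taking \<open>Suc n\<close> instead of \<open>n\<close> keeps the bound
  positive.\<close>

lemma mem_metric_lss_iff:
  "\<B> \<in> metric_lss X d \<longleftrightarrow>
     \<B> \<subseteq> Pow X \<and> (\<exists>n. \<forall>B\<in>\<B>. infinity_diameter d B \<le> of_nat (Suc n))"
proof -
  have "(\<exists>n. \<forall>B\<in>\<B>. infinity_diameter d B \<le> of_nat (Suc n))"
    if M: "\<And>B. B \<in> \<B> \<Longrightarrow> infinity_diameter d B \<le> ennreal M" for M :: real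
  proof -
    obtain n where "M \<le> real n" using real_arch_simple by blast
    then have "ennreal M \<le> ennreal (real (Suc n))" by (intro ennreal_leI) simp
    then have "ennreal M \<le> of_nat (Suc n)" by (simp only: ennreal_of_nat_eq_real_of_nat)
    then show ?thesis using M order_trans by blast
  qed
  moreover have "\<exists>M::real. M > 0 \<and> (\<forall>B\<in>\<B>. infinity_diameter d B \<le> ennreal M)"
    if "\<forall>B\<in>\<B>. infinity_diameter d B \<le> of_nat (Suc n)" for n
    using that unfolding ennreal_of_nat_eq_real_of_nat by (intro exI[of _ "real (Suc n)"]) simp
  ultimately show ?thesis unfolding metric_lss_def by blast
qed

lemma infinity_diameter_singleton:
  assumes "infinity_metric_on X d" "x \<in> X"
  shows "infinity_diameter d {x} = 0"
  using assms by (simp add: infinity_diameter_def infinity_metric_on_def)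

text \<open>Two points of the star are joined in three hops: inside an element of
  \<open>\<U>\<close> to a point of \<open>B\<close>, across \<open>B\<close>, and inside an element
  of \<open>\<U>\<close> again.\<close>

lemma infinity_diameter_star_le:
  assumes d: "infinity_metric_on X d" and X: "B \<subseteq> X" "\<U> \<subseteq> Pow X"
    and B: "infinity_diameter d B \<le> a" and \<U>: "\<And>U. U \<in> \<U> \<Longrightarrow> infinity_diameter d U \<le> b"
  shows "infinity_diameter d (star B \<U>) \<le> b + (a + b)"
  unfolding infinity_diameter_le_iff
proof (intro ballI)
  fix u v assume "u \<in> star B \<U>" "v \<in> star B \<U>"
  then obtain U V x y where *: "u \<in> U" "x \<in> U" "U \<in> \<U>" "x \<in> B" "v \<in> V" "y \<in> V" "V \<in> \<U>" "y \<in> B"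
    unfolding star_def by blast
  then have X': "u \<in> X" "x \<in> X" "y \<in> X" "v \<in> X" using X by auto
  have "d u v \<le> d u x + d x v" "d x v \<le> d x y + d y v"
    using d X' unfolding infinity_metric_on_def by blast+
  moreover have "d u x \<le> b" "d x y \<le> a" "d y v \<le> b"
    using B \<U>[OF \<open>U \<in> \<U>\<close>] \<U>[OF \<open>V \<in> \<U>\<close>] * unfolding infinity_diameter_le_iff by blast+
  ultimately show "d u v \<le> b + (a + b)"
    by (meson add_mono order_trans)
qed

section \<open>Metric structures are countably generated\<close>

lemma metric_lss_generated_by_countable:
  assumes d: "infinity_metric_on X d"
  shows "\<exists>\<L>'. countable \<L>' \<and> generated_by X (metric_lss X d) \<L>'"
proof -
  define C where "C n = {B. B \<subseteq> X \<and> infinity_diameter d B \<le> of_nat (Suc n)}" for n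
  have C_X: "C n \<subseteq> Pow X" for n by (auto simp: C_def)
  have mono: "C m \<subseteq> C n" if "m \<le> n" for m n
  proof -
    have "(of_nat (Suc m) :: ennreal) \<le> of_nat (Suc n)"
      using that unfolding of_nat_le_iff by simp
    then show ?thesis by (auto simp: C_def intro: order_trans)
  qed
  \<comment> \<open>The index comes from the three-hop bound: (n + 1) + (m + 1) + (n + 1) is the
    successor of m + 2(n + 1).\<close>
  have directed: "refines (C m \<union> C n \<union> star_family (C m) (C n)) (C (m + 2 * Suc n))" for m n
  proof -
    have "star B (C n) \<in> C (m + 2 * Suc n)" if "B \<in> C m" for B
    proof -
      have "infinity_diameter d (star B (C n)) \<le> of_nat (Suc n) + (of_nat (Suc m) + of_nat (Suc n))"
        by (rule infinity_diameter_star_le[OF d]) (use that in \<open>auto simp: C_def\<close>)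
      also have "\<dots> = of_nat (Suc (m + 2 * Suc n))"
        unfolding of_nat_add[symmetric] by (rule arg_cong[where f = of_nat]) simp
      finally show ?thesis using C_X[of n] by (auto simp: C_def star_def)
    qed
    moreover have "C m \<subseteq> C (m + 2 * Suc n)" "C n \<subseteq> C (m + 2 * Suc n)"
      by (rule mono, simp)+
    ultimately show ?thesis unfolding refines_def star_family_def by blast
  qed
  \<comment> \<open>Singletons have diameter 0 and already belong to every \<open>C n\<close>, so
    trivial extensions disappear from the generation condition.\<close>
  have singletons: "trivial_extension X (C n) = C n" for n
    by (auto simp: trivial_extension_def C_def infinity_diameter_singleton[OF d])
  have "\<B> \<in> metric_lss X d \<longleftrightarrow> (\<exists>n. refines \<B> (C n))" for \<B>
  proof -
    \<comment> \<open>Each \<open>C n\<close> is closed under subsets, because the diameter is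
      monotone.\<close>
    have "refines \<B> (C n) \<longleftrightarrow> \<B> \<subseteq> C n" for n
      unfolding refines_def C_def by (blast intro: order_trans[OF infinity_diameter_mono])
    then show ?thesis unfolding mem_metric_lss_iff C_def by blast
  qed
  then have "metric_lss X d = {\<B>. \<exists>n. refines \<B> (C n)}"
    by blast
  moreover have "\<exists>k. refines (C m \<union> C n \<union> star_family (C m) (C n)) (C k)" for m n
    using directed by blast
  ultimately have "generated_by X (metric_lss X d) (range C)"
    unfolding generated_by_def using C_X by (simp add: singletons)
  then show ?thesis by (intro exI[of _ "range C"]) simp
qed

section \<open>Countably generated structures are metric\<close>

lemma infinity_metric_of_entourages:
  fixes R :: "nat \<Rightarrow> ('a \<times> 'a) set"
  assumes refl: "\<And>n x. x \<in> X \<Longrightarrow> (x, x) \<in> R n"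
    and sym: "\<And>n. sym (R n)"
    and mono: "\<And>n. R n \<subseteq> R (Suc n)"
    and comp: "\<And>n. R n O R n \<subseteq> R (Suc n)"
  obtains d where "infinity_metric_on X d"
    and "\<And>n x y. x \<in> X \<Longrightarrow> y \<in> X \<Longrightarrow> d x y \<le> of_nat (Suc n) \<longleftrightarrow> (x, y) \<in> R n"
proof -
  define N where "N x y = (LEAST n. (x, y) \<in> R n)" for x y
  \<comment> \<open>Off the diagonal the values are positive integers or infinity, so the bound n +
    1 cuts out exactly \<open>R n\<close>. The diagonal is set to 0 separately, since the least
    index would give 1 at points of \<open>X\<close>. \<open>N\<close> is consulted only where a
    least index exists.\<close>
  define d :: "'a \<Rightarrow> 'a \<Rightarrow> ennreal" where
    "d x y = (if x = y then 0 else if \<exists>n. (x, y) \<in> R n then of_nat (Suc (N x y)) else top)" for x y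
  have le: "R m \<subseteq> R n" if "m \<le> n" for m n
    using that mono by (rule lift_Suc_mono_le[rotated])
  have d_le: "d x y \<le> of_nat (Suc n) \<longleftrightarrow> (x, y) \<in> R n" if "x \<in> X" for n x y
  proof (cases "\<exists>n. (x, y) \<in> R n")
    case True
    then have "(x, y) \<in> R (N x y)" unfolding N_def by (rule LeastI_ex)
    then have "N x y \<le> n \<longleftrightarrow> (x, y) \<in> R n"
      using le N_def by (metis Least_le subsetD)
    then show ?thesis
      using True refl that by (auto simp: d_def simp del: of_nat_Suc)
  next
    case False
    then show ?thesis using refl that by (auto simp: d_def top_unique simp del: of_nat_Suc)
  qed
  have d_cases: "d x y = top \<or> (\<exists>n. d x y = of_nat (Suc n))" if "x \<noteq> y" for x y
    using that by (auto simp: d_def simp del: of_nat_Suc)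
  have triangle: "d x z \<le> d x y + d y z" if X: "x \<in> X" "y \<in> X" for x y z
  proof (cases "x = y \<or> y = z \<or> d x y = top \<or> d y z = top")
    case True
    moreover have "d x x = 0" "d y y = 0" by (simp_all add: d_def)
    ultimately show ?thesis by auto
  next
    case False
    then obtain m n where mn: "d x y = of_nat (Suc m)" "d y z = of_nat (Suc n)"
      using d_cases by meson
    then have "(x, y) \<in> R m" "(y, z) \<in> R n" using d_le X by (metis order_refl)+
    \<comment> \<open>Since \<open>comp\<close> composes a relation only with itself, both pairs are
      first moved to the larger index.\<close>
    then have "(x, y) \<in> R (max m n)" "(y, z) \<in> R (max m n)"
      using le[of m "max m n"] le[of n "max m n"] by auto
    then have "(x, z) \<in> R (Suc (max m n))" using comp by blast
    then have "d x z \<le> of_nat (Suc (Suc (max m n)))" using d_le X by blast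
    also have "\<dots> \<le> of_nat (Suc m + Suc n)" unfolding of_nat_le_iff by simp
    finally show ?thesis unfolding mn of_nat_add .
  qed
  have "(x, y) \<in> R n \<longleftrightarrow> (y, x) \<in> R n" for x y n
    using sym by (meson symD)
  then have "d x y = d y x" for x y
    by (simp add: d_def N_def)
  moreover have "d x y = 0 \<longleftrightarrow> x = y" for x y
    by (simp add: d_def)
  ultimately have "infinity_metric_on X d"
    unfolding infinity_metric_on_def using triangle by blast
  then show thesis using that d_le by blast
qed

text \<open>Each step of the recursion uses directedness twice: once to absorb the current family
  and its star with itself, once to absorb the next family of an enumeration. Every family is
  enumerated at some stage, hence cofinality.\<close>

lemma countably_generated_chain:
  assumes "countable \<L>'" "\<L>' \<noteq> {}"
    and directed: "\<forall>\<B>1\<in>\<L>'. \<forall>\<B>2\<in>\<L>'. \<exists>\<B>3\<in>\<L>'. refines (\<B>1 \<union> \<B>2 \<union> star_family \<B>1 \<B>2) \<B>3"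
  obtains C where "\<And>n. C n \<in> \<L>'"
    and "\<And>n. refines (C n) (C (Suc n))"
    and "\<And>n. refines (star_family (C n) (C n)) (C (Suc n))"
    and "\<And>\<B>. \<B> \<in> \<L>' \<Longrightarrow> \<exists>n. refines \<B> (C n)"
proof -
  obtain f where f: "\<And>\<A> \<B>. \<A> \<in> \<L>' \<Longrightarrow> \<B> \<in> \<L>' \<Longrightarrow> f \<A> \<B> \<in> \<L>'"
    "\<And>\<A> \<B>. \<A> \<in> \<L>' \<Longrightarrow> \<B> \<in> \<L>' \<Longrightarrow> refines (\<A> \<union> \<B> \<union> star_family \<A> \<B>) (f \<A> \<B>)"
    using directed by metis
  \<comment> \<open>As \<open>\<L>'\<close> is nonempty, this enumerates it even when it is finite,
    with repetitions.\<close>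
  define A where "A = from_nat_into \<L>'"
  define C where "C = rec_nat (A 0) (\<lambda>n \<C>. f (f \<C> \<C>) (A n))"
  have C_Suc: "C (Suc n) = f (f (C n) (C n)) (A n)" for n by (simp add: C_def)
  have A: "A n \<in> \<L>'" for n using assms(2) unfolding A_def by (rule from_nat_into)
  have C: "C n \<in> \<L>'" for n
    by (induction n) (auto simp: C_Suc A f(1), simp add: C_def A)
  have step: "refines (f (C n) (C n)) (C (Suc n))" "refines (A n) (C (Suc n))" for n
    using f(2)[OF f(1)[OF C[of n] C[of n]] A[of n]] by (simp_all add: C_Suc refines_Un_iff)
  have *: "refines (C n) (f (C n) (C n))" "refines (star_family (C n) (C n)) (f (C n) (C n))" for n
    using f(2)[OF C[of n] C[of n]] by (simp_all add: refines_Un_iff)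
  show thesis
  proof (rule that[of C])
    show "\<exists>n. refines \<B> (C n)" if "\<B> \<in> \<L>'" for \<B>
      using step(2) from_nat_into_surj[OF \<open>countable \<L>'\<close> that] unfolding A_def by metis
  qed (use C * step(1) refines_trans in blast)+
qed

text \<open>Uniformly bounded families have bounded diameters by cofinality of the chain.
  Conversely, a diameter bound controls only pairs of points; one star, and hence one further index,
  turns this into containment of whole sets.\<close>

lemma countably_generated_imp_metric_lss:
  assumes lss: "large_scale_structure X \<L>" and "countable \<L>'" and gen: "generated_by X \<L> \<L>'"
  shows "\<exists>d. infinity_metric_on X d \<and> \<L> = metric_lss X d"
proof -
  have \<L>: "\<L> = {\<B>. \<exists>\<B>'\<in>\<L>'. refines \<B> (trivial_extension X \<B>')}"
    using gen by (simp add: generated_by_def)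
  \<comment> \<open>An empty set of generators would generate the empty set, whereas a large scale
    structure is nonempty.\<close>
  have "\<L>' \<noteq> {}" using lss \<L> by (auto simp: large_scale_structure_def)
  moreover have "\<forall>\<B>1\<in>\<L>'. \<forall>\<B>2\<in>\<L>'. \<exists>\<B>3\<in>\<L>'. refines (\<B>1 \<union> \<B>2 \<union> star_family \<B>1 \<B>2) \<B>3"
    using gen by (simp add: generated_by_def)
  ultimately obtain C where C: "\<And>n. C n \<in> \<L>'"
    and mono: "\<And>n. refines (C n) (C (Suc n))"
    and star: "\<And>n. refines (star_family (C n) (C n)) (C (Suc n))"
    and cofinal: "\<And>\<B>. \<B> \<in> \<L>' \<Longrightarrow> \<exists>n. refines \<B> (C n)"
    using countably_generated_chain[OF \<open>countable \<L>'\<close>] by metis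
  have star_C: "\<exists>V\<in>C (Suc n). star U (C n) \<subseteq> V" if "U \<in> C n" for n U
    using star[of n] that by (auto simp: refines_def star_family_def)
  have C_\<L>: "C n \<in> \<L>" for n
    using C[of n] refines_trivial_extension[of "C n" X] unfolding \<L> by blast
  \<comment> \<open>\<open>Id\<close> supplies reflexivity at points that no element of
    \<open>C n\<close> covers; it is the counterpart of the trivial extension.\<close>
  define R where "R n = Id \<union> (\<Union>U\<in>C n. U \<times> U)" for n
  have R_mono: "R n \<subseteq> R (Suc n)" for n
  proof (rule subrelI)
    fix x y assume "(x, y) \<in> R n"
    then consider "x = y" | U where "U \<in> C n" "x \<in> U" "y \<in> U" unfolding R_def by blast
    then show "(x, y) \<in> R (Suc n)"
    proof cases
      case 2
      then obtain V where "V \<in> C (Suc n)" "U \<subseteq> V" using mono[of n] unfolding refines_def by blast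
      with 2 show ?thesis unfolding R_def by blast
    qed (simp add: R_def)
  qed
  have "R n O R n \<subseteq> R (Suc n)" for n
  proof (rule subrelI)
    fix x z assume "(x, z) \<in> R n O R n"
    then obtain y where y: "(x, y) \<in> R n" "(y, z) \<in> R n" by blast
    show "(x, z) \<in> R (Suc n)"
    proof (cases "x = y \<or> y = z")
      case True
      then show ?thesis using y R_mono[of n] by auto
    next
      case False
      then obtain U V where UV: "U \<in> C n" "V \<in> C n" "x \<in> U" "y \<in> U" "y \<in> V" "z \<in> V"
        using y unfolding R_def by blast
      \<comment> \<open>\<open>U\<close> meets itself and \<open>V\<close> meets \<open>U\<close> in
        \<open>y\<close>, so both lie in the star of \<open>U\<close>.\<close>
      then have "{x, z} \<subseteq> star U (C n)" unfolding star_def by blast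
      moreover obtain W where "W \<in> C (Suc n)" "star U (C n) \<subseteq> W" using star_C[OF UV(1)] by blast
      ultimately show ?thesis unfolding R_def by blast
    qed
  qed
  moreover have "sym (R n)" "(x, x) \<in> R n" for n x by (auto simp: R_def sym_def)
  ultimately obtain d where d: "infinity_metric_on X d"
    and d_le: "\<And>n x y. x \<in> X \<Longrightarrow> y \<in> X \<Longrightarrow> d x y \<le> of_nat (Suc n) \<longleftrightarrow> (x, y) \<in> R n"
    using infinity_metric_of_entourages[of X R] R_mono by metis
  have "\<L> = metric_lss X d"
  proof (intro equalityI subsetI)
    fix \<B> assume "\<B> \<in> \<L>"
    then have "\<B> \<subseteq> Pow X" using lss by (auto simp: large_scale_structure_def)
    from \<open>\<B> \<in> \<L>\<close> obtain \<B>' where "\<B>' \<in> \<L>'" "refines \<B> (trivial_extension X \<B>')"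
      unfolding \<L> by blast
    moreover from this obtain n where "refines \<B>' (C n)" using cofinal by blast
    ultimately have n: "refines \<B> (trivial_extension X (C n))"
      using trivial_extension_mono refines_trans by blast
    have R: "(x, y) \<in> R n" if "B \<in> \<B>" "x \<in> B" "y \<in> B" for B x y
    proof -
      obtain U where "U \<in> trivial_extension X (C n)" "B \<subseteq> U"
        using n \<open>B \<in> \<B>\<close> unfolding refines_def by meson
      moreover from this have "x \<in> U" "y \<in> U" using that by auto
      ultimately show ?thesis unfolding trivial_extension_def R_def by auto
    qed
    have "infinity_diameter d B \<le> of_nat (Suc n)" if "B \<in> \<B>" for B
      unfolding infinity_diameter_le_iff
      using that R \<open>\<B> \<subseteq> Pow X\<close> by (metis PowD d_le subsetD)
    then show "\<B> \<in> metric_lss X d"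
      unfolding mem_metric_lss_iff using \<open>\<B> \<subseteq> Pow X\<close> by blast
  next
    fix \<B> assume "\<B> \<in> metric_lss X d"
    then obtain n where "\<B> \<subseteq> Pow X"
      and diam: "\<And>B. B \<in> \<B> \<Longrightarrow> infinity_diameter d B \<le> of_nat (Suc n)"
      unfolding mem_metric_lss_iff by blast
    have R: "(x, y) \<in> R n" if "B \<in> \<B>" "x \<in> B" "y \<in> B" for B x y
    proof -
      have "d x y \<le> of_nat (Suc n)"
        using diam[OF \<open>B \<in> \<B>\<close>] that unfolding infinity_diameter_le_iff by blast
      then show ?thesis using d_le that \<open>\<B> \<subseteq> Pow X\<close> by blast
    qed
    \<comment> \<open>The second point \<open>y\<close> is there to provide an element
      \<open>U\<close> of \<open>C n\<close> containing \<open>x\<close>. Any other point of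
      \<open>B\<close> shares with \<open>x\<close> an element of \<open>C n\<close>, and this
      element meets \<open>U\<close> in \<open>x\<close>; hence the star of \<open>U\<close>
      contains \<open>B\<close>.\<close>
    have "\<exists>V\<in>C (Suc n). B \<subseteq> V" if "B \<in> \<B>" "x \<in> B" "y \<in> B" "x \<noteq> y" for B x y
    proof -
      have "(x, y) \<in> R n" using R that by blast
      then obtain U where U: "U \<in> C n" "x \<in> U" using \<open>x \<noteq> y\<close> unfolding R_def by blast
      have "B \<subseteq> star U (C n)"
      proof
        fix z assume "z \<in> B"
        then have "(x, z) \<in> R n" using R that by blast
        then show "z \<in> star U (C n)" using U unfolding R_def star_def by blast
      qed
      then show ?thesis using star_C[OF U(1)] by blast
    qed
    then show "\<B> \<in> \<L>"
      by (rule large_scale_structure_coarse_refinement[OF lss C_\<L> \<open>\<B> \<subseteq> Pow X\<close>])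
  qed
  with d show ?thesis by blast
qed

theorem theorem1p8:
  fixes X :: "'a set" and \<L> :: "'a set set set"
  assumes "large_scale_structure X \<L>"
  shows "(\<exists>d. infinity_metric_on X d \<and> \<L> = metric_lss X d) \<longleftrightarrow>
         (\<exists>\<L>'. countable \<L>' \<and> generated_by X \<L> \<L>')"
  using metric_lss_generated_by_countable countably_generated_imp_metric_lss[OF assms] by blast

end
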